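(* Let $M$ be an $n$-dimensional $C^k$-smooth manifold, let $(U,\varphi)$ be a chart on $M$, and let $\bar P$ be the lift to $M$ of a $C^{k'}$-coordinate independent property $P$ (of functions on $\mathbb{R}^n$), with $k'\le k$. Let $N$ be a shift-invariant iterative method of order at most $k$ that computes $P$ with rate $K>1$. Define $$E_f(p)=\varphi^{-1}\circ\theta_{\varphi(p)}\circ N_{f\circ\varphi^{-1}\circ\theta_{\varphi(p)}}(0)\qquad\text{for }p\in U,$$ where $\theta_x(y)=x+y$. Then $E_f$ computes $\bar P$ on $U$ with rate $K$, meaning: for any function $f\colon M\to\mathbb{R}$ and any $p^*\in U\cap\bar P_f$, the iteration function $E_f$ converges locally with rate $K$ to $p^*$.
   Context: Functions written $f\colon\mathbb{R}^n\to\mathbb{R}$ are only required to be defined on a subset $\operatorname{Dom}f\subset\mathbb{R}^n$; iteration functions may be only partially defined. Coordinate independent property. Assign to each $f\colon\operatorname{Dom}f\subset\mathbb{R}^n\to\mathbb{R}$ a subset $P_f$ of the interior of $\operatorname{Dom}f$. The property $P=\{P_f\}$ is $C^k$-coordinate independent if $x\in P_f$ implies $\phi^{-1}(x)\in P_{f\circ\phi}$ for every $C^k$-diffeomorphism $\phi$ of open sets in $\mathbb{R}^n$ with $x$ in the image of $\phi$. Lift. Let $\mathcal{A}$ be the maximal atlas of $C^k$-smooth charts of $M$. For $f\colon M\to\mathbb{R}$, $\bar P_f=\{p\in M\mid\exists(V,\chi)\in\mathcal{A},\ p\in V,\ \chi(p)\in P_{f\circ\chi^{-1}}\}$. Iterative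 method. Two functions $f,g$ are $m$-jet equivalent at $p\in\mathbb{R}^n$ if both are $C^m$-smooth in a neighbourhood of $p$ and $f(p)=g(p)$, $Df(p)=Dg(p)$, ..., $D^mf(p)=D^mg(p)$. An $m$th-order iterative method is the assignment of an iteration function $N_f\colon\mathbb{R}^n\to\mathbb{R}^n$ to each $f\colon\mathbb{R}^n\to\mathbb{R}$ such that $N_f(p)=N_g(p)$ whenever $f$ and $g$ are $m$-jet equivalent at $p$. It computes $P$ with rate $K$ if for any $f$ and any $x^*\in P_f$, $N_f$ converges locally to $x^*$ with rate $K$. It is shift-invariant if $\theta_z\circ N_{f\circ\theta_z}\circ\theta_z^{-1}(x)=N_f(x)$ for all $f$, $x$, $z$, where $\theta_z(y)=z+y$. Convergence. An iteration function $N$ on $\mathbb{R}^n$ converges locally to $x^*$ with rate $K>1$ if there are $\kappa\in\mathbb{R}$ and an open $U\ni x^*$ such that $N$ is defined on $U$ and for all $x\in U$: $N(x)\in U$ and $\|N(x)-x^*\|\le\kappa\|x-x^*\|^K$. An iteration function $E$ on a $C^1$-manifold converges locally with rate $K>1$ to $p^*$ if there is a coordinate chart $\chi$ defined on a neighbourhood of $p^*$ such that $\chi\circ E\circ\chi^{-1}$ converges locally with rate $K$ to $\chi(p^* )$.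
   Formalization: Added assumption, as the literal claim fails for nonlocal P and N with nonsmooth f: either f∘φ⁻¹ is C^m near φ(p* ) (m the order of N), or P is local (x in P of a restriction of f to an open set implies x in P_f), or N_f(x) is unchanged by restricting f to an open neighbourhood of x. *)

theory Defs
  imports "HOL-Analysis.Analysis" "HOL-Library.Extended_Nat"
begin

text \<open>
  Partially defined functions are maps \<open>'a \<rightharpoonup> 'b\<close>, composed by \<open>\<circ>\<^sub>m\<close>; an equation between two
  values of such functions says that both are undefined or both are defined and equal.
\<close>

definition partial_on :: "'a set \<Rightarrow> ('a \<Rightarrow> 'b) \<Rightarrow> ('a \<rightharpoonup> 'b)" where
  "partial_on S g = (\<lambda>x. if x \<in> S then Some (g x) else None)"

definition shift :: "'a::plus \<Rightarrow> ('a \<rightharpoonup> 'a)" where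
  "shift z = (\<lambda>y. Some (z + y))"


section \<open>Differentiability classes and jets\<close>

text \<open>
  \<open>Cm_on m S f\<close> is meant for open \<open>S\<close>. In finite dimension the derivative \<open>Df\<close> is of class \<open>C\<^sup>m\<close> iff
  \<open>x \<mapsto> Df(x) v\<close> is of class \<open>C\<^sup>m\<close> for every vector \<open>v\<close>.
\<close>

primrec Cm_on :: "nat \<Rightarrow> 'a::euclidean_space set \<Rightarrow> ('a \<Rightarrow> 'b::real_normed_vector) \<Rightarrow> bool" where
  "Cm_on 0 S f \<longleftrightarrow> continuous_on S f"
| "Cm_on (Suc m) S f \<longleftrightarrow>
     (\<forall>x\<in>S. f differentiable (at x)) \<and>
     (\<forall>v. Cm_on m S (\<lambda>x. frechet_derivative f (at x) v))"

definition Ck_on :: "enat \<Rightarrow> 'a::euclidean_space set \<Rightarrow> ('a \<Rightarrow> 'b::real_normed_vector) \<Rightarrow> bool" where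
  "Ck_on k S f \<longleftrightarrow> (\<forall>m. enat m \<le> k \<longrightarrow> Cm_on m S f)"

definition Ck_diffeo ::
  "enat \<Rightarrow> 'a::euclidean_space set \<Rightarrow> 'a set \<Rightarrow> ('a \<Rightarrow> 'a) \<Rightarrow> bool" where
  "Ck_diffeo k S T \<phi> \<longleftrightarrow>
     open S \<and> open T \<and> bij_betw \<phi> S T \<and> Ck_on k S \<phi> \<and> Ck_on k T (inv_into S \<phi>)"

text \<open>\<open>nth_deriv [v\<^sub>j, \<dots>, v\<^sub>1] f p\<close> is the value of the \<open>j\<close>-linear map \<open>D\<^sup>jf(p)\<close> at \<open>(v\<^sub>1, \<dots>, v\<^sub>j)\<close>.\<close>

primrec nth_deriv ::
  "'a list \<Rightarrow> ('a::euclidean_space \<Rightarrow> 'b::real_normed_vector) \<Rightarrow> 'a \<Rightarrow> 'b" where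
  "nth_deriv [] f = f"
| "nth_deriv (v # vs) f = (\<lambda>x. frechet_derivative (nth_deriv vs f) (at x) v)"

definition Cm_near ::
  "nat \<Rightarrow> ('a::euclidean_space \<rightharpoonup> 'b::real_normed_vector) \<Rightarrow> 'a \<Rightarrow> bool" where
  "Cm_near m f p \<longleftrightarrow> (\<exists>W. open W \<and> p \<in> W \<and> W \<subseteq> dom f \<and> Cm_on m W (\<lambda>x. the (f x)))"

definition jet_equiv ::
  "nat \<Rightarrow> ('a::euclidean_space \<rightharpoonup> 'b::real_normed_vector) \<Rightarrow> ('a \<rightharpoonup> 'b) \<Rightarrow> 'a \<Rightarrow> bool" where
  "jet_equiv m f g p \<longleftrightarrow>
     Cm_near m f p \<and> Cm_near m g p \<and>
     (\<forall>vs. length vs \<le> m \<longrightarrow>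
        nth_deriv vs (\<lambda>x. the (f x)) p = nth_deriv vs (\<lambda>x. the (g x)) p)"


section \<open>Manifolds\<close>

text \<open>
  A chart is a pair \<open>(U, \<phi>)\<close>; the values of \<open>\<phi>\<close> outside \<open>U\<close> are irrelevant.
\<close>

type_synonym ('m, 'n) chart = "'m set \<times> ('m \<Rightarrow> real ^ 'n)"

definition is_chart :: "'m topology \<Rightarrow> ('m, 'n::finite) chart \<Rightarrow> bool" where
  "is_chart X = (\<lambda>(U, \<phi>). openin X U \<and> open (\<phi> ` U) \<and>
     homeomorphic_map (subtopology X U) (top_of_set (\<phi> ` U)) \<phi>)"

definition compatible :: "enat \<Rightarrow> ('m, 'n::finite) chart \<Rightarrow> ('m, 'n) chart \<Rightarrow> bool" where
  "compatible k = (\<lambda>(U, \<phi>) (V, \<psi>).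
     Ck_diffeo k (\<phi> ` (U \<inter> V)) (\<psi> ` (U \<inter> V)) (\<psi> \<circ> inv_into U \<phi>))"

definition is_maximal_atlas :: "enat \<Rightarrow> 'm topology \<Rightarrow> ('m, 'n::finite) chart set \<Rightarrow> bool" where
  "is_maximal_atlas k X \<A> \<longleftrightarrow>
     (\<forall>c\<in>\<A>. is_chart X c) \<and>
     (\<Union>c\<in>\<A>. fst c) = topspace X \<and>
     (\<forall>c\<in>\<A>. \<forall>d\<in>\<A>. compatible k c d) \<and>
     (\<forall>c. is_chart X c \<and> (\<forall>d\<in>\<A>. compatible k c d \<and> compatible k d c) \<longrightarrow> c \<in> \<A>)"

definition Ck_manifold :: "enat \<Rightarrow> 'm topology \<Rightarrow> ('m, 'n::finite) chart set \<Rightarrow> bool" where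
  "Ck_manifold k X \<A> \<longleftrightarrow>
     Hausdorff_space X \<and> second_countable X \<and> is_maximal_atlas k X \<A>"

definition chart_map :: "('m, 'n) chart \<Rightarrow> ('m \<rightharpoonup> real ^ 'n)" where
  "chart_map = (\<lambda>(U, \<phi>). partial_on U \<phi>)"

definition chart_inv :: "('m, 'n) chart \<Rightarrow> (real ^ 'n \<rightharpoonup> 'm)" where
  "chart_inv = (\<lambda>(U, \<phi>). partial_on (\<phi> ` U) (inv_into U \<phi>))"


section \<open>Coordinate independent properties\<close>

type_synonym 'n property = "(real ^ 'n \<rightharpoonup> real) \<Rightarrow> (real ^ 'n) set"

definition coordinate_independent :: "enat \<Rightarrow> 'n::finite property \<Rightarrow> bool" where
  "coordinate_independent k P \<longleftrightarrow>
     (\<forall>f. P f \<subseteq> interior (dom f)) \<and>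
     (\<forall>f S T \<phi> x. Ck_diffeo k S T \<phi> \<and> x \<in> T \<and> x \<in> P f \<longrightarrow>
        inv_into S \<phi> x \<in> P (f \<circ>\<^sub>m partial_on S \<phi>))"

definition lift :: "('m, 'n::finite) chart set \<Rightarrow> 'n property \<Rightarrow> ('m \<rightharpoonup> real) \<Rightarrow> 'm set" where
  "lift \<A> P f = {p. \<exists>(V, \<psi>)\<in>\<A>. p \<in> V \<and> \<psi> p \<in> P (f \<circ>\<^sub>m chart_inv (V, \<psi>))}"

text \<open>
  Coordinate independence only gives the converse implication, from \<open>f\<close> to its restriction \<open>f |` W\<close>
  (take \<open>\<phi>\<close> to be the identity of \<open>W\<close>).
\<close>

definition local_property :: "'n::finite property \<Rightarrow> bool" where
  "local_property P \<longleftrightarrow> (\<forall>f W x. open W \<and> x \<in> W \<and> x \<in> P (f |` W) \<longrightarrow> x \<in> P f)"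


section \<open>Iterative methods\<close>

type_synonym 'n iter_method = "(real ^ 'n \<rightharpoonup> real) \<Rightarrow> (real ^ 'n \<rightharpoonup> real ^ 'n)"

definition iterative_method :: "nat \<Rightarrow> 'n::finite iter_method \<Rightarrow> bool" where
  "iterative_method m N \<longleftrightarrow> (\<forall>f g p. jet_equiv m f g p \<longrightarrow> N f p = N g p)"

definition shift_invariant :: "'n::finite iter_method \<Rightarrow> bool" where
  "shift_invariant N \<longleftrightarrow>
     (\<forall>f x z. (shift z \<circ>\<^sub>m N (f \<circ>\<^sub>m shift z) \<circ>\<^sub>m shift (- z)) x = N f x)"

text \<open>
  For an iterative method of order \<open>m\<close> the following equation holds automatically whenever \<open>f\<close> is of
  class \<open>C\<^sup>m\<close> near \<open>x\<close>, because \<open>f\<close> and \<open>f |` W\<close> are then \<open>m\<close>-jet equivalent at \<open>x\<close>. If \<open>f\<close> is not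
  \<open>C\<^sup>m\<close> near \<open>x\<close>, then it is not \<open>m\<close>-jet equivalent at \<open>x\<close> to any function, its own restrictions
  included.
\<close>

definition local_method :: "'n::finite iter_method \<Rightarrow> bool" where
  "local_method N \<longleftrightarrow> (\<forall>f W x. open W \<and> x \<in> W \<longrightarrow> N (f |` W) x = N f x)"

text \<open>In the estimate, \<open>0 powr K = 0\<close>, so that \<open>N x\<^sub>0 = Some x\<^sub>0\<close> is forced.\<close>

definition converges_locally ::
  "('a::real_normed_vector \<rightharpoonup> 'a) \<Rightarrow> 'a \<Rightarrow> real \<Rightarrow> bool" where
  "converges_locally N x\<^sub>0 K \<longleftrightarrow>
     (\<exists>\<kappa> U. open U \<and> x\<^sub>0 \<in> U \<and>
        (\<forall>x\<in>U. \<exists>y\<in>U. N x = Some y \<and> norm (y - x\<^sub>0) \<le> \<kappa> * norm (x - x\<^sub>0) powr K))"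

definition converges_locally_on_manifold ::
  "('m, 'n::finite) chart set \<Rightarrow> ('m \<rightharpoonup> 'm) \<Rightarrow> 'm \<Rightarrow> real \<Rightarrow> bool" where
  "converges_locally_on_manifold \<A> E p K \<longleftrightarrow>
     (\<exists>(V, \<psi>)\<in>\<A>. p \<in> V \<and>
        converges_locally (chart_map (V, \<psi>) \<circ>\<^sub>m E \<circ>\<^sub>m chart_inv (V, \<psi>)) (\<psi> p) K)"

definition computes :: "'n::finite iter_method \<Rightarrow> 'n property \<Rightarrow> real \<Rightarrow> bool" where
  "computes N P K \<longleftrightarrow> (\<forall>f. \<forall>x\<in>P f. converges_locally (N f) x K)"

definition method_via_chart ::
  "('m, 'n::finite) chart \<Rightarrow> 'n iter_method \<Rightarrow> ('m \<rightharpoonup> real) \<Rightarrow> ('m \<rightharpoonup> 'm)" where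
  "method_via_chart = (\<lambda>(U, \<phi>) N f p.
     if p \<in> U
     then (chart_inv (U, \<phi>) \<circ>\<^sub>m shift (\<phi> p) \<circ>\<^sub>m
             N (f \<circ>\<^sub>m chart_inv (U, \<phi>) \<circ>\<^sub>m shift (\<phi> p))) 0
     else None)"

end

theory Submission
  imports Defs
begin

text \<open>
  Write \<open>g = f \<circ> \<phi>\<inverse>\<close> and let \<open>E\<close> be the iteration on \<open>U\<close>. Read in the chart \<open>(U, \<phi>)\<close>, it is \<open>N g\<close>:
  shift invariance says that \<open>\<theta>\<^sub>x (N (g \<circ> \<theta>\<^sub>x) 0) = N g x\<close>, so the translations that make \<open>E\<close> evaluate
  \<open>N\<close> at the origin cancel (\<open>method_via_chart_in_chart\<close>). It therefore suffices that \<open>N g\<close>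
  converges locally to \<open>\<phi> p\<close>.

  Membership of \<open>p\<close> in the lift is witnessed by some chart \<open>(V, \<psi>)\<close>. The transition map
  \<open>\<psi> \<circ> \<phi>\<inverse>\<close> is a diffeomorphism only between the images of \<open>U \<inter> V\<close>, so coordinate independence moves
  \<open>\<psi> p \<in> P (f \<circ> \<psi>\<inverse>)\<close> to \<open>\<phi> p \<in> P (g |` S)\<close> with \<open>S = \<phi> ` (U \<inter> V)\<close>, not to \<open>\<phi> p \<in> P g\<close>
  (\<open>lift_in_chart\<close>). Hence what is known at first is that \<open>N (g |` S)\<close> converges
  locally to \<open>\<phi> p\<close>. Passing from \<open>g |` S\<close> to \<open>g\<close> is the purpose of the last hypothesis: if \<open>g\<close> is
  \<open>C\<^sup>m\<close> near \<open>\<phi> p\<close>, then \<open>g\<close> and \<open>g |` S\<close> have the same \<open>m\<close>-jets there, so \<open>N\<close> cannot tell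
  them apart (\<open>jet_equiv_restrict\<close>); the other two alternatives grant the passage for \<open>P\<close> or for \<open>N\<close>.

  Both steps replace an iteration by one that agrees with it only near the limit, and \<open>E\<close> is
  moreover defined only where \<open>N g\<close> does not leave \<open>\<phi> ` U\<close>. That local convergence survives this is
  \<open>converges_locally_transfer\<close>: for \<open>K > 1\<close> the iteration maps every sufficiently small ball around
  the limit into itself.
\<close>

section \<open>Local convergence and the germ of the iteration\<close>

text \<open>
  On a ball of radius \<open>r\<close> with \<open>\<kappa> r\<^sup>K\<^sup>-\<^sup>1 \<le> 1\<close> the estimate \<open>\<kappa> d\<^sup>K = (\<kappa> d\<^sup>K\<^sup>-\<^sup>1) d \<le> d\<close> shows that the
  distance to the limit does not increase. So small balls are invariant, and \<open>W\<close> contains one.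
\<close>

lemma converges_locally_transfer:
  assumes conv: "converges_locally N x\<^sub>0 K" and "K > 1"
    and "open W" "x\<^sub>0 \<in> W"
    and agree: "\<And>x y. x \<in> W \<Longrightarrow> y \<in> W \<Longrightarrow> N x = Some y \<Longrightarrow> N' x = Some y"
  shows "converges_locally N' x\<^sub>0 K"
proof -
  obtain \<kappa> U where "open U" "x\<^sub>0 \<in> U"
    and U: "\<And>x. x \<in> U \<Longrightarrow> \<exists>y\<in>U. N x = Some y \<and> norm (y - x\<^sub>0) \<le> \<kappa> * norm (x - x\<^sub>0) powr K"
    using conv unfolding converges_locally_def by blast
  have "open (U \<inter> W)" "x\<^sub>0 \<in> U \<inter> W"
    using \<open>open U\<close> \<open>open W\<close> \<open>x\<^sub>0 \<in> U\<close> \<open>x\<^sub>0 \<in> W\<close> by auto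
  then obtain e where "e > 0" and e: "ball x\<^sub>0 e \<subseteq> U \<inter> W"
    by (meson openE)
  \<comment> \<open>The given \<open>\<kappa>\<close> may be zero or negative; \<open>L\<close> is positive, so the radius can be solved from \<open>L r\<^sup>K\<^sup>-\<^sup>1 = 1\<close>.\<close>
  define L where "L = max 1 \<kappa>"
  define r where "r = min e ((1 / L) powr (1 / (K - 1)))"
  have "L > 0" by (simp add: L_def)
  then have "r > 0" using \<open>e > 0\<close> by (simp add: r_def)
  have "ball x\<^sub>0 r \<subseteq> U \<inter> W" using e by (auto simp: r_def)
  have contract: "\<kappa> * d powr K \<le> d" if "0 \<le> d" "d < r" for d
  proof (cases "d = 0")
    case False
    have "d powr (K - 1) \<le> ((1 / L) powr (1 / (K - 1))) powr (K - 1)"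
      using that \<open>K > 1\<close> by (intro powr_mono2) (auto simp: r_def)
    also have "\<dots> = 1 / L"
      using \<open>K > 1\<close> \<open>L > 0\<close> by (simp add: powr_powr)
    finally have "L * d powr (K - 1) \<le> 1"
      using \<open>L > 0\<close> by (simp add: field_simps)
    then have "(L * d powr (K - 1)) * d \<le> 1 * d"
      using that by (intro mult_right_mono) auto
    moreover have "d powr K = d powr (K - 1) * d"
      using that False by (simp add: powr_diff)
    moreover have "\<kappa> * d powr K \<le> L * d powr K"
      by (intro mult_right_mono) (auto simp: L_def)
    ultimately show ?thesis by (simp add: mult.assoc)
  qed simp
  have "\<exists>y\<in>ball x\<^sub>0 r. N' x = Some y \<and> norm (y - x\<^sub>0) \<le> \<kappa> * norm (x - x\<^sub>0) powr K"
    if x: "x \<in> ball x\<^sub>0 r" for x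
  proof -
    have "x \<in> U" "x \<in> W" using x \<open>ball x\<^sub>0 r \<subseteq> U \<inter> W\<close> by auto
    then obtain y where y: "N x = Some y" "norm (y - x\<^sub>0) \<le> \<kappa> * norm (x - x\<^sub>0) powr K"
      using U by blast
    have "norm (x - x\<^sub>0) < r" using x by (simp add: dist_norm norm_minus_commute)
    then have "norm (y - x\<^sub>0) < r"
      using y(2) contract[of "norm (x - x\<^sub>0)"] by simp
    then have "y \<in> ball x\<^sub>0 r" by (simp add: dist_norm norm_minus_commute)
    then have "y \<in> W" using \<open>ball x\<^sub>0 r \<subseteq> U \<inter> W\<close> by auto
    then show ?thesis using agree \<open>x \<in> W\<close> y \<open>y \<in> ball x\<^sub>0 r\<close> by blast
  qed
  then show ?thesis
    unfolding converges_locally_def using \<open>r > 0\<close>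
    by (intro exI[of _ \<kappa>] exI[of _ "ball x\<^sub>0 r"]) auto
qed


section \<open>Jets depend only on the germ of the function\<close>

text \<open>
  Since \<^const>\<open>frechet_derivative\<close> chooses some derivative, two functions with the same derivatives at
  \<open>x\<close> get the same choice, differentiable or not.
\<close>

lemma frechet_derivative_cong_open:
  assumes "open S" "x \<in> S" and eq: "\<And>y. y \<in> S \<Longrightarrow> f y = g y"
  shows "frechet_derivative f (at x) = frechet_derivative g (at x)"
proof -
  have "(f has_derivative D) (at x) \<longleftrightarrow> (g has_derivative D) (at x)" for D
    using has_derivative_transform_within_open[OF _ assms(1,2)] eq by metis
  then show ?thesis by (simp add: frechet_derivative_def)
qed

lemma nth_deriv_cong_open:
  assumes "open S" and eq: "\<And>y. y \<in> S \<Longrightarrow> f y = g y" and "x \<in> S"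
  shows "nth_deriv vs f x = nth_deriv vs g x"
  using \<open>x \<in> S\<close>
proof (induction vs arbitrary: x)
  case (Cons v vs)
  then show ?case
    using frechet_derivative_cong_open[OF \<open>open S\<close> Cons.prems Cons.IH] by simp
qed (simp add: eq)

lemma Cm_on_cong_open:
  assumes "open S" and "\<And>y. y \<in> S \<Longrightarrow> f y = g y" and "Cm_on m S f"
  shows "Cm_on m S g"
  using assms(2,3)
proof (induction m arbitrary: f g)
  case 0
  then show ?case by (auto cong: continuous_on_cong)
next
  case (Suc m)
  have "g differentiable (at x)" if "x \<in> S" for x
    using that Suc.prems has_derivative_transform_within_open[OF _ \<open>open S\<close> that]
    by (fastforce simp: differentiable_def)
  moreover have "Cm_on m S (\<lambda>x. frechet_derivative g (at x) v)" for v
  proof (rule Suc.IH)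
    show "Cm_on m S (\<lambda>x. frechet_derivative f (at x) v)" using Suc.prems by simp
    show "frechet_derivative f (at x) v = frechet_derivative g (at x) v" if "x \<in> S" for x
      using frechet_derivative_cong_open[OF \<open>open S\<close> that Suc.prems(1)] by simp
  qed
  ultimately show ?case by simp
qed

lemma Cm_on_subset:
  assumes "Cm_on m S f" "T \<subseteq> S"
  shows "Cm_on m T f"
  using assms by (induction m arbitrary: f) (auto intro: continuous_on_subset)

lemma jet_equiv_restrict:
  assumes "Cm_near m g x" "open S" "x \<in> S"
  shows "jet_equiv m (g |` S) g x"
proof -
  obtain W where W: "open W" "x \<in> W" "W \<subseteq> dom g" "Cm_on m W (\<lambda>y. the (g y))"
    using assms(1) unfolding Cm_near_def by blast
  have "Cm_on m (W \<inter> S) (\<lambda>y. the ((g |` S) y))"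
    by (rule Cm_on_cong_open[OF _ _ Cm_on_subset[OF W(4)]]) (use W \<open>open S\<close> in auto)
  then have "Cm_near m (g |` S) x"
    unfolding Cm_near_def using W assms by (intro exI[of _ "W \<inter> S"]) auto
  moreover have "nth_deriv vs (\<lambda>y. the ((g |` S) y)) x = nth_deriv vs (\<lambda>y. the (g y)) x" for vs
    by (rule nth_deriv_cong_open[OF \<open>open S\<close>]) (use \<open>x \<in> S\<close> in auto)
  ultimately show ?thesis using assms(1) by (simp add: jet_equiv_def)
qed

text \<open>
  Being \<open>C\<^sup>m\<close> near \<open>x\<^sub>0\<close> is an open condition, so the equality of jets behind the invariance of the
  method holds at all points near \<open>x\<^sub>0\<close> and not only at \<open>x\<^sub>0\<close>.
\<close>

lemma iterative_method_restrict:
  assumes "iterative_method m N" "Cm_near m g x\<^sub>0" "open S" "x\<^sub>0 \<in> S"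
  obtains W where "open W" "x\<^sub>0 \<in> W" "\<And>x. x \<in> W \<Longrightarrow> N (g |` S) x = N g x"
proof -
  obtain W where W: "open W" "x\<^sub>0 \<in> W" "W \<subseteq> dom g" "Cm_on m W (\<lambda>y. the (g y))"
    using assms(2) unfolding Cm_near_def by blast
  have "N (g |` S) x = N g x" if "x \<in> W \<inter> S" for x
  proof -
    have "Cm_near m g x" using W that unfolding Cm_near_def by blast
    then show ?thesis
      using jet_equiv_restrict[OF _ \<open>open S\<close>] that assms(1) unfolding iterative_method_def by blast
  qed
  then show thesis using that[of "W \<inter> S"] W assms(3,4) by blast
qed

text \<open>
  The three alternatives are three ways of forgetting that \<open>g\<close> was restricted: the jets agree,
  \<open>P\<close> forgets it, or \<open>N\<close> forgets it.
\<close>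

lemma converges_locally_unrestrict:
  assumes "iterative_method m N" "computes N P K" "K > 1"
    and "open S" "x\<^sub>0 \<in> S" and P: "x\<^sub>0 \<in> P (g |` S)"
    and "Cm_near m g x\<^sub>0 \<or> local_property P \<or> local_method N"
  shows "converges_locally (N g) x\<^sub>0 K"
proof -
  have conv: "converges_locally (N (g |` S)) x\<^sub>0 K"
    using assms(2) P unfolding computes_def by blast
  consider "Cm_near m g x\<^sub>0" | "local_property P" | "local_method N" using assms(7) by blast
  then show ?thesis
  proof cases
    case 1
    then obtain W where "open W" "x\<^sub>0 \<in> W" "\<And>x. x \<in> W \<Longrightarrow> N (g |` S) x = N g x"
      using iterative_method_restrict assms(1,4,5) by metis
    then show ?thesis using converges_locally_transfer[OF conv \<open>K > 1\<close>] by metis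
  next
    case 2
    then have "x\<^sub>0 \<in> P g" using P assms(4,5) unfolding local_property_def by blast
    then show ?thesis using assms(2) unfolding computes_def by blast
  next
    case 3
    then have "N (g |` S) x = N g x" if "x \<in> S" for x
      using that \<open>open S\<close> unfolding local_method_def by blast
    then show ?thesis using converges_locally_transfer[OF conv \<open>K > 1\<close> assms(4,5)] by metis
  qed
qed


section \<open>Lifted properties read in an arbitrary chart\<close>

lemma is_chart_inj_on: "is_chart X (U, \<phi>) \<Longrightarrow> inj_on \<phi> U"
  unfolding is_chart_def
  by (auto simp: homeomorphic_eq_everything_map Int_absorb1 dest: openin_subset)

lemma Ck_diffeo_le: "Ck_diffeo k S T \<tau> \<Longrightarrow> k' \<le> k \<Longrightarrow> Ck_diffeo k' S T \<tau>"
  unfolding Ck_diffeo_def Ck_on_def using order_trans by blast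

text \<open>
  The transition map sees only the overlap of the two charts; this is where the restriction to
  \<open>\<phi> ` (U \<inter> V)\<close> comes from.
\<close>

lemma chart_inv_transition:
  assumes "inj_on \<phi> U" "inj_on \<psi> V"
  shows "f \<circ>\<^sub>m chart_inv (V, \<psi>) \<circ>\<^sub>m partial_on (\<phi> ` (U \<inter> V)) (\<psi> \<circ> inv_into U \<phi>)
       = (f \<circ>\<^sub>m chart_inv (U, \<phi>)) |` (\<phi> ` (U \<inter> V))"
proof
  fix x
  show "(f \<circ>\<^sub>m chart_inv (V, \<psi>) \<circ>\<^sub>m partial_on (\<phi> ` (U \<inter> V)) (\<psi> \<circ> inv_into U \<phi>)) x
      = ((f \<circ>\<^sub>m chart_inv (U, \<phi>)) |` (\<phi> ` (U \<inter> V))) x"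
  proof (cases "x \<in> \<phi> ` (U \<inter> V)")
    case True
    then obtain q where "q \<in> U" "q \<in> V" "x = \<phi> q" by blast
    then show ?thesis using assms
      by (simp add: map_comp_def partial_on_def chart_inv_def)
  next
    case False
    then show ?thesis by (simp add: map_comp_def partial_on_def)
  qed
qed

lemma lift_in_chart:
  assumes atlas: "is_maximal_atlas k X \<A>" and U: "(U, \<phi>) \<in> \<A>"
    and indep: "coordinate_independent k' P" and "k' \<le> k"
    and p: "p \<in> U" "p \<in> lift \<A> P f"
  obtains S where "open S" "\<phi> p \<in> S" "\<phi> p \<in> P ((f \<circ>\<^sub>m chart_inv (U, \<phi>)) |` S)"
proof -
  obtain V \<psi> where V: "(V, \<psi>) \<in> \<A>" "p \<in> V" "\<psi> p \<in> P (f \<circ>\<^sub>m chart_inv (V, \<psi>))"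
    using p(2) unfolding lift_def by blast
  define S where "S = \<phi> ` (U \<inter> V)"
  define \<tau> where "\<tau> = \<psi> \<circ> inv_into U \<phi>"
  have inj: "inj_on \<phi> U" "inj_on \<psi> V"
    using atlas U V(1) is_chart_inj_on unfolding is_maximal_atlas_def by blast+
  have "compatible k (U, \<phi>) (V, \<psi>)"
    using atlas U V(1) unfolding is_maximal_atlas_def by blast
  then have diffeo: "Ck_diffeo k' S (\<psi> ` (U \<inter> V)) \<tau>"
    using \<open>k' \<le> k\<close> Ck_diffeo_le unfolding compatible_def S_def \<tau>_def by auto
  have "\<phi> p \<in> S" using p(1) V(2) by (simp add: S_def)
  have "\<tau> (\<phi> p) = \<psi> p"
    using inj(1) p(1) by (simp add: \<tau>_def)
  moreover have "inj_on \<tau> S" using diffeo by (simp add: Ck_diffeo_def bij_betw_def)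
  ultimately have "inv_into S \<tau> (\<psi> p) = \<phi> p"
    using \<open>\<phi> p \<in> S\<close> by (metis inv_into_f_f)
  moreover have "\<psi> p \<in> \<psi> ` (U \<inter> V)" using p(1) V(2) by blast
  ultimately have "\<phi> p \<in> P (f \<circ>\<^sub>m chart_inv (V, \<psi>) \<circ>\<^sub>m partial_on S \<tau>)"
    using indep diffeo V(3) unfolding coordinate_independent_def by metis
  then have "\<phi> p \<in> P ((f \<circ>\<^sub>m chart_inv (U, \<phi>)) |` S)"
    unfolding S_def \<tau>_def chart_inv_transition[OF inj] .
  then show thesis
    using that[of S] \<open>\<phi> p \<in> S\<close> diffeo by (simp add: Ck_diffeo_def)
qed


section \<open>The manifold iteration in its defining chart\<close>

lemma map_comp_assoc: "h \<circ>\<^sub>m k \<circ>\<^sub>m l = h \<circ>\<^sub>m (k \<circ>\<^sub>m l)"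
  by (rule ext) (simp add: map_comp_def split: option.split)

text \<open>
  Shift invariance at the point \<open>x\<close> with the translation \<open>\<theta>\<^sub>x\<close> reads
  \<open>N g x = x + N (g \<circ> \<theta>\<^sub>x) 0\<close>, with \<open>g = f \<circ> \<phi>\<inverse>\<close>, because \<open>\<theta>\<^sub>x\<close> carries \<open>0\<close> to \<open>x\<close>. The value has to lie in the image
  of the chart, since only there \<open>\<phi>\<inverse>\<close> can be applied to it.
\<close>

lemma method_via_chart_in_chart:
  assumes "inj_on \<phi> U" "shift_invariant N" and x: "x \<in> \<phi> ` U" and y: "y \<in> \<phi> ` U"
    and N: "N (f \<circ>\<^sub>m chart_inv (U, \<phi>)) x = Some y"
  shows "(chart_map (U, \<phi>) \<circ>\<^sub>m method_via_chart (U, \<phi>) N f \<circ>\<^sub>m chart_inv (U, \<phi>)) x = Some y"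
proof -
  define g where "g = f \<circ>\<^sub>m chart_inv (U, \<phi>)"
  obtain q where q: "q \<in> U" "y = \<phi> q" using y by blast
  obtain a where a: "a \<in> U" "x = \<phi> a" using x by blast
  have "(shift x \<circ>\<^sub>m N (g \<circ>\<^sub>m shift x) \<circ>\<^sub>m shift (- x)) x = Some y"
    using assms(2) N unfolding shift_invariant_def g_def by metis
  then have "(shift x \<circ>\<^sub>m N (g \<circ>\<^sub>m shift x)) 0 = Some y"
    by (simp add: map_comp_def shift_def)
  moreover have "chart_inv (U, \<phi>) y = Some q"
    using q \<open>inj_on \<phi> U\<close> by (simp add: chart_inv_def partial_on_def)
  ultimately have "method_via_chart (U, \<phi>) N f a = Some q"
    using a by (simp add: method_via_chart_def g_def map_comp_assoc map_comp_simps(2))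
  then show ?thesis
    using q a \<open>inj_on \<phi> U\<close> by (simp add: map_comp_def chart_map_def chart_inv_def partial_on_def)
qed

theorem proposition25:
  fixes X :: "'m topology"
    and \<A> :: "('m, 'n::finite) chart set"
    and k k' :: enat
    and U :: "'m set" and \<phi> :: "'m \<Rightarrow> real ^ 'n"
    and P :: "'n property"
    and N :: "'n iter_method"
    and m :: nat and K :: real
    and f :: "'m \<rightharpoonup> real" and p :: 'm
  assumes "Ck_manifold k X \<A>"
    and "(U, \<phi>) \<in> \<A>"
    and "coordinate_independent k' P" and "k' \<le> k"
    and "iterative_method m N" and "enat m \<le> k"
    and "shift_invariant N"
    and "K > 1" and "computes N P K"
    and "p \<in> U \<inter> lift \<A> P f"
    and "Cm_near m (f \<circ>\<^sub>m chart_inv (U, \<phi>)) (\<phi> p) \<or> local_property P \<or> local_method N"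
  shows "converges_locally_on_manifold \<A> (method_via_chart (U, \<phi>) N f) p K"
proof -
  let ?g = "f \<circ>\<^sub>m chart_inv (U, \<phi>)"
  have atlas: "is_maximal_atlas k X \<A>" using assms(1) by (simp add: Ck_manifold_def)
  then have chart: "is_chart X (U, \<phi>)" using assms(2) unfolding is_maximal_atlas_def by blast
  have "p \<in> U" "p \<in> lift \<A> P f" using assms(10) by auto
  then obtain S where "open S" "\<phi> p \<in> S" "\<phi> p \<in> P (?g |` S)"
    using lift_in_chart[OF atlas assms(2,3,4)] by blast
  then have "converges_locally (N ?g) (\<phi> p) K"
    using converges_locally_unrestrict assms(5,8,9,11) by blast
  then have "converges_locally
      (chart_map (U, \<phi>) \<circ>\<^sub>m method_via_chart (U, \<phi>) N f \<circ>\<^sub>m chart_inv (U, \<phi>)) (\<phi> p) K"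
  proof (rule converges_locally_transfer[OF _ \<open>K > 1\<close>])
    show "open (\<phi> ` U)" using chart by (simp add: is_chart_def)
    show "\<phi> p \<in> \<phi> ` U" using \<open>p \<in> U\<close> by blast
  qed (rule method_via_chart_in_chart[OF is_chart_inj_on[OF chart] assms(7)])
  then show ?thesis
    unfolding converges_locally_on_manifold_def using assms(2) \<open>p \<in> U\<close> by blast
qed

end
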